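(* Let $T_0$ be a finite subset of $\Omega$. (a) If $\Omega$ is a locally compact Hausdorff space, then for every $f\in CV_0(\Omega,X)$, $\varepsilon>0$, $v\in V$ and $p\in\mathcal{A}$, there is $u\in C_c(\Omega,\mathbb{C})\otimes X\subset CV_0(\Omega,X)$ such that $|f-u|_{v,p}<\varepsilon$, $u|_{T_0}=f|_{T_0}$, $u(\Omega)\subset co(f(\Omega)\cup\{0\})$, and $\operatorname{supp} u\subset\operatorname{supp} f$. (b) If $\Omega$ is a completely regular Hausdorff space, then for every $f\in C_b(\Omega,X)$, $\varepsilon>0$, $v\in C_0(\Omega,\mathbb{R}_+)$ and $p\in\mathcal{A}$, there is $u\in C_b(\Omega,\mathbb{C})\otimes X$ such that $|f-u|_{v,p}<\varepsilon$, $u|_{T_0}=f|_{T_0}$, $u(\Omega)\subset co(f(\Omega))$, and $\operatorname{supp} u\subset\operatorname{supp} f$.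
   Context: $\Omega$ is a topological space. $X$ is a complex locally convex topological vector space (not assumed Hausdorff) whose topology is given by a family $\mathcal{A}$ of seminorms. $V$ is a Nachbin family, i.e. a set of upper semicontinuous functions $\Omega\to\mathbb{R}_+=[0,\infty)$. $C(\Omega,X)$ is the set of continuous maps $\Omega\to X$; $C_b(\Omega,X)$ is the subset of bounded ones (each $p\circ f$, $p\in\mathcal{A}$, bounded). $\operatorname{supp} f$ is the closure of $\{x:f(x)\ne0\}$; $C_c(\Omega,X)$ is the set of $f\in C(\Omega,X)$ with compact support. $C_0(\Omega,\mathbb{R}_+)$ is the set of continuous $v:\Omega\to[0,\infty)$ with $\{x:v(x)\ge\epsilon\}$ compact for all $\epsilon>0$. $CV_0(\Omega,X)$ is the set of $f\in C(\Omega,X)$ such that for all $v\in V$, $p\in\mathcal{A}$, $\epsilon>0$ the set $\{x\in\Omega:v(x)p(f(x))\ge\epsilon\}$ is compact. Put $|f|_{v,p}=\sup_{x\in\Omega}v(x)p(f(x))$. For $A\subset C(\Omega,\mathbb{C})$, $A\otimes X$ is the linear span of the functions $t\mapsto\varphi(t)x$, $\varphi\in A$, $x\in X$. For $X_0\subset X$, $co(X_0)$ denotes the closed convex hull, i.e. the closure of the set of all finite convex combinations of elements of $X_0$.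
   Formalization: The inclusion supp u ⊂ supp f, in (a) and (b), is claimed only if every t in T_0 with f(t) ≠ 0 is interior to supp f. This is automatic for Hausdorff X; without it the claim fails, e.g. Ω = ℝ, X = ℂ with only the zero seminorm, f nonzero only at 0, T_0 = {0}. *)

theory Defs
  imports "HOL-Analysis.Analysis" "HOL-Library.Function_Algebras"
begin

text \<open>
  The topological space \<open>\<Omega>\<close> is an abstract topology (so it may be empty), and a function on \<open>\<Omega>\<close> is a
  function on the underlying type of which only the values on \<open>topspace \<Omega>\<close> matter. The complex vector
  space \<open>X\<close> is a whole type, with scalar multiplication \<open>smul\<close>.
\<close>

definition seminorm :: "(complex \<Rightarrow> 'x \<Rightarrow> 'x) \<Rightarrow> ('x::ab_group_add \<Rightarrow> real) \<Rightarrow> bool" where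
  "seminorm smul p \<longleftrightarrow>
     (\<forall>x. 0 \<le> p x) \<and> (\<forall>x y. p (x + y) \<le> p x + p y) \<and> (\<forall>c x. p (smul c x) = cmod c * p x)"

text \<open>
  \<open>UNIV\<close> is included among the generators so that the carrier is the whole type also when the family
  of seminorms is empty (\<open>topology_generated_by\<close> takes the union of the generators as its carrier).
\<close>

definition seminorm_topology :: "('x::ab_group_add \<Rightarrow> real) set \<Rightarrow> 'x topology" where
  "seminorm_topology \<A> =
     topology_generated_by (insert UNIV {{y. p (y - x) < r} | p x r. p \<in> \<A> \<and> 0 < r})"

definition upper_semicontinuous_map :: "'a topology \<Rightarrow> ('a \<Rightarrow> real) \<Rightarrow> bool" where
  "upper_semicontinuous_map \<Omega> v \<longleftrightarrow> (\<forall>a. openin \<Omega> {t \<in> topspace \<Omega>. v t < a})"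

definition nachbin_family :: "'a topology \<Rightarrow> ('a \<Rightarrow> real) set \<Rightarrow> bool" where
  "nachbin_family \<Omega> V \<longleftrightarrow>
     (\<forall>v\<in>V. upper_semicontinuous_map \<Omega> v \<and> (\<forall>t\<in>topspace \<Omega>. 0 \<le> v t))"

definition supp :: "'a topology \<Rightarrow> ('a \<Rightarrow> 'x::zero) \<Rightarrow> 'a set" where
  "supp \<Omega> f = \<Omega> closure_of {t \<in> topspace \<Omega>. f t \<noteq> 0}"

definition Cc :: "'a topology \<Rightarrow> 'x topology \<Rightarrow> ('a \<Rightarrow> 'x::zero) set" where
  "Cc \<Omega> T = {f. continuous_map \<Omega> T f \<and> compactin \<Omega> (supp \<Omega> f)}"

text \<open>In \<open>Cb \<Omega> T \<A>\<close>, \<open>\<A>\<close> is a family of seminorms giving the topology \<open>T\<close>.\<close>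

definition Cb :: "'a topology \<Rightarrow> 'x topology \<Rightarrow> ('x \<Rightarrow> real) set \<Rightarrow> ('a \<Rightarrow> 'x) set" where
  "Cb \<Omega> T \<A> = {f. continuous_map \<Omega> T f \<and> (\<forall>p\<in>\<A>. bounded ((\<lambda>t. p (f t)) ` topspace \<Omega>))}"

definition C0_nonneg :: "'a topology \<Rightarrow> ('a \<Rightarrow> real) set" where
  "C0_nonneg \<Omega> = {v. continuous_map \<Omega> euclideanreal v \<and> (\<forall>t\<in>topspace \<Omega>. 0 \<le> v t) \<and>
     (\<forall>\<epsilon>>0. compactin \<Omega> {t \<in> topspace \<Omega>. v t \<ge> \<epsilon>})}"

definition CV0 ::
  "'a topology \<Rightarrow> ('x::ab_group_add \<Rightarrow> real) set \<Rightarrow> ('a \<Rightarrow> real) set \<Rightarrow> ('a \<Rightarrow> 'x) set" where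
  "CV0 \<Omega> \<A> V = {f. continuous_map \<Omega> (seminorm_topology \<A>) f \<and>
     (\<forall>v\<in>V. \<forall>p\<in>\<A>. \<forall>\<epsilon>>0. compactin \<Omega> {t \<in> topspace \<Omega>. v t * p (f t) \<ge> \<epsilon>})}"

text \<open>
  The supremum is taken in \<open>[0,\<infinity>]\<close>, so that it is \<open>0\<close> on the empty space and \<open>\<infinity>\<close> when unbounded.
\<close>

definition weighted_sup ::
  "'a topology \<Rightarrow> ('a \<Rightarrow> real) \<Rightarrow> ('x \<Rightarrow> real) \<Rightarrow> ('a \<Rightarrow> 'x) \<Rightarrow> ennreal" where
  "weighted_sup \<Omega> v p f = (SUP t\<in>topspace \<Omega>. ennreal (v t * p (f t)))"

definition tensor ::
  "(complex \<Rightarrow> 'x \<Rightarrow> 'x) \<Rightarrow> ('a \<Rightarrow> complex) set \<Rightarrow> ('a \<Rightarrow> 'x::ab_group_add) set" where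
  "tensor smul A =
     module.span (\<lambda>c f t. smul c (f t)) {\<lambda>t. smul (\<phi> t) x | \<phi> x. \<phi> \<in> A}"

definition closed_convex_hull ::
  "(complex \<Rightarrow> 'x \<Rightarrow> 'x) \<Rightarrow> ('x::ab_group_add \<Rightarrow> real) set \<Rightarrow> 'x set \<Rightarrow> 'x set" where
  "closed_convex_hull smul \<A> S = seminorm_topology \<A> closure_of
     {\<Sum>x\<in>F. smul (complex_of_real (c x)) x | F c.
        finite F \<and> F \<subseteq> S \<and> (\<forall>x\<in>F. 0 \<le> c x) \<and> (\<Sum>x\<in>F. c x) = 1}"

text \<open>
  A function in \<open>tensor smul A\<close>, with \<open>A\<close> consisting of continuous functions, is nonzero on an open
  set; hence such a function \<open>u\<close> with \<open>u t = f t \<noteq> 0\<close> and \<open>supp \<Omega> u \<subseteq> supp \<Omega> f\<close> exists only if \<open>t\<close> is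
  interior to \<open>supp \<Omega> f\<close>. The next lemma gives this for Hausdorff \<open>X\<close>. It can fail otherwise: if \<open>\<Omega>\<close> is
  the real line and the seminorms on \<open>X\<close> all vanish, take \<open>f\<close> to be zero except at one point.
\<close>

lemma nonzero_imp_interior_supp:
  fixes f :: "'a \<Rightarrow> 'x::ab_group_add"
  assumes "Hausdorff_space (seminorm_topology \<A>)"
    and f: "continuous_map \<Omega> (seminorm_topology \<A>) f"
    and t: "t \<in> topspace \<Omega>" "f t \<noteq> 0"
  shows "t \<in> \<Omega> interior_of (supp \<Omega> f)"
proof -
  let ?T = "seminorm_topology \<A>"
  have top: "topspace ?T = UNIV"
    by (auto simp: seminorm_topology_def)
  have "closedin ?T {0}"
    using assms(1) top by (simp add: closedin_Hausdorff_singleton)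
  then have "openin ?T (topspace ?T - {0})"
    by (rule openin_diff[OF openin_topspace])
  from openin_continuous_map_preimage[OF f this]
  have op: "openin \<Omega> {s \<in> topspace \<Omega>. f s \<noteq> 0}"
    by (simp add: top)
  have "{s \<in> topspace \<Omega>. f s \<noteq> 0} \<subseteq> supp \<Omega> f"
    unfolding supp_def by (rule closure_of_subset) auto
  then have "{s \<in> topspace \<Omega>. f s \<noteq> 0} \<subseteq> \<Omega> interior_of (supp \<Omega> f)"
    using op by (rule interior_of_maximal)
  with t show ?thesis by blast
qed

end

theory Submission
  imports Defs
begin

text \<open>
  In both parts \<open>u = y0 + (\<Sum>i\<in>F. \<phi> i (f i - y0))\<close>, where \<open>\<phi>\<close> is a partition of unity on the compact set of
  those \<open>t\<close> with \<open>v t * p (f t - y0) \<ge> e\<close> or with \<open>t \<in> T0\<close> and \<open>f t \<noteq> y0\<close>, and \<open>\<phi> i\<close> vanishes unless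
  \<open>v s * p (f s - f i) < e\<close>. Then \<open>f - u\<close> is pointwise a convex combination of differences of weighted
  seminorm at most \<open>e\<close>. The background value \<open>y0\<close> is \<open>0\<close> in part (a). In part (b) it must be a value of
  \<open>f\<close>: it can be taken to be \<open>0\<close> when \<open>supp \<Omega> f\<close> is a proper subset, and when \<open>supp \<Omega> f\<close> is everything any
  value will do, because the support condition is void. Where \<open>p (f t) > 0\<close>, \<open>t\<close> is automatically
  interior to \<open>supp \<Omega> f\<close>, so the \<open>\<phi> i\<close> can be supported there.
\<close>

section \<open>Partitions of unity on a compact set\<close>

text \<open>Complete regularity yields at each point of \<open>K\<close> a bump vanishing off
  \<open>U t\<close>. By compactness finitely many bumps have a sum bounded away from
  \<open>0\<close> on \<open>K\<close>, and this sum is normalised. The indices are points of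
  \<open>K\<close>, so that the values \<open>f i\<close> can later serve as coefficients.\<close>

lemma completely_regular_partition_of_unity:
  assumes cr: "completely_regular_space X" and K: "compactin X K"
    and U: "\<And>t. t \<in> K \<Longrightarrow> openin X (U t) \<and> t \<in> U t"
  obtains F and \<phi> :: "'a \<Rightarrow> 'a \<Rightarrow> real" where
    "finite F" "F \<subseteq> K" "\<And>i. i \<in> F \<Longrightarrow> continuous_map X euclideanreal (\<phi> i)"
    "\<And>i t. i \<in> F \<Longrightarrow> t \<in> topspace X \<Longrightarrow> 0 \<le> \<phi> i t"
    "\<And>t. t \<in> topspace X \<Longrightarrow> (\<Sum>i\<in>F. \<phi> i t) \<le> 1"
    "\<And>t. t \<in> K \<Longrightarrow> (\<Sum>i\<in>F. \<phi> i t) = 1"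
    "\<And>i t. i \<in> F \<Longrightarrow> t \<in> topspace X \<Longrightarrow> \<phi> i t \<noteq> 0 \<Longrightarrow> t \<in> U i"
proof -
  have "\<exists>g. continuous_map X euclideanreal g \<and> g t = 1 \<and>
      (\<forall>s\<in>topspace X. 0 \<le> g s \<and> (g s \<noteq> 0 \<longrightarrow> s \<in> U t))" if t: "t \<in> K" for t
  proof -
    have "closedin X (topspace X - U t)" "t \<in> topspace X - (topspace X - U t)"
      using U[OF t] openin_subset by fastforce+
    with cr obtain h where h: "continuous_map X (top_of_set {0..1::real}) h" "h t = 0"
        "h ` (topspace X - U t) \<subseteq> {1}"
      unfolding completely_regular_space_def by metis
    have "h s \<in> {0..1}" if "s \<in> topspace X" for s
      using h(1) that by (auto simp: continuous_map_in_subtopology)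
    moreover have "continuous_map X euclideanreal (\<lambda>s. 1 - h s)"
      using h(1) by (auto simp: continuous_map_in_subtopology intro!: continuous_intros)
    ultimately show ?thesis
      using h by (intro exI[of _ "\<lambda>s. 1 - h s"]) fastforce
  qed
  then obtain g where g: "\<And>t. t \<in> K \<Longrightarrow> continuous_map X euclideanreal (g t)"
      "\<And>t. t \<in> K \<Longrightarrow> g t t = (1::real)"
      "\<And>t s. t \<in> K \<Longrightarrow> s \<in> topspace X \<Longrightarrow> 0 \<le> g t s"
      "\<And>t s. t \<in> K \<Longrightarrow> s \<in> topspace X \<Longrightarrow> g t s \<noteq> 0 \<Longrightarrow> s \<in> U t"
    by metis
  define N where "N t = {s \<in> topspace X. g t s \<in> {1/2<..}}" for t
  have "openin X (N t)" if "t \<in> K" for t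
    unfolding N_def by (rule openin_continuous_map_preimage[OF g(1)[OF that]]) auto
  moreover have "K \<subseteq> \<Union>(N ` K)"
    using g(2) compactin_subset_topspace[OF K] by (fastforce simp: N_def)
  ultimately obtain F where F: "finite F" "F \<subseteq> K" "K \<subseteq> \<Union>(N ` F)"
    using K unfolding compactin_def by (metis (no_types, lifting) finite_subset_image image_iff)
  define S where "S t = (\<Sum>i\<in>F. g i t)" for t
  \<comment> \<open>The sum \<open>S\<close> may vanish off \<open>K\<close>, so the denominator is
    cut off below at \<open>1/2\<close>. It is still at least \<open>S\<close>, which bounds the
    total by \<open>1\<close>, and it equals \<open>S\<close> on \<open>K\<close>, where the sets
    \<open>N i\<close> force \<open>S > 1/2\<close>.\<close>
  define \<phi> where "\<phi> i t = g i t / max (1/2) (S t)" for i t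
  have sum: "(\<Sum>i\<in>F. \<phi> i t) = S t / max (1/2) (S t)" for t
    by (simp add: \<phi>_def S_def sum_divide_distrib)
  have S_K: "1/2 < S t" if t: "t \<in> K" for t
  proof -
    obtain i where i: "i \<in> F" "t \<in> N i" using F(3) t by blast
    then have "g i t \<le> S t"
      unfolding S_def using F g(3) by (intro member_le_sum) (auto simp: N_def)
    with i show ?thesis by (simp add: N_def)
  qed
  have S_cont: "continuous_map X euclideanreal S"
    unfolding S_def using F g(1) by (intro continuous_map_sum) auto
  show thesis
  proof (rule that[of F \<phi>])
    show "continuous_map X euclideanreal (\<phi> i)" if "i \<in> F" for i
      unfolding \<phi>_def using that F g(1)
      by (intro continuous_map_real_divide continuous_map_real_max S_cont) auto
    show "0 \<le> \<phi> i t" if "i \<in> F" "t \<in> topspace X" for i t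
      using that g(3) F unfolding \<phi>_def by (intro divide_nonneg_nonneg) auto
    show "(\<Sum>i\<in>F. \<phi> i t) \<le> 1" for t
      unfolding sum by (simp add: divide_le_eq max_def)
    show "(\<Sum>i\<in>F. \<phi> i t) = 1" if "t \<in> K" for t
      unfolding sum using S_K[OF that] by (simp add: max_def)
    show "t \<in> U i" if "i \<in> F" "t \<in> topspace X" "\<phi> i t \<noteq> 0" for i t
      using that g(4) F by (auto simp: \<phi>_def)
  qed (use F in auto)
qed

section \<open>Seminorms, the topology they generate, and semicontinuous weights\<close>

lemma seminorm_nonneg: "seminorm smul p \<Longrightarrow> 0 \<le> p x"
  and seminorm_triangle: "seminorm smul p \<Longrightarrow> p (x + y) \<le> p x + p y"
  and seminorm_smul: "seminorm smul p \<Longrightarrow> p (smul c x) = cmod c * p x"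
  by (auto simp: seminorm_def)

lemma seminorm_zero:
  assumes "vector_space smul" "seminorm smul p"
  shows "p 0 = 0"
proof -
  interpret vector_space smul by fact
  show ?thesis using seminorm_smul[OF assms(2), of 0 0] by simp
qed

lemma seminorm_diff_commute:
  assumes "vector_space smul" "seminorm smul p"
  shows "p (x - y) = p (y - x)"
proof -
  interpret vector_space smul by fact
  show ?thesis using seminorm_smul[OF assms(2), of "-1" "y - x"] by simp
qed

lemma seminorm_sum_le:
  assumes "vector_space smul" "seminorm smul p"
  shows "p (\<Sum>i\<in>F. g i) \<le> (\<Sum>i\<in>F. p (g i))"
proof (induction F rule: infinite_finite_induct)
  case (insert i F)
  then show ?case
    using seminorm_triangle[OF assms(2), of "g i" "\<Sum>i\<in>F. g i"] by simp
qed (simp_all add: seminorm_zero[OF assms])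

lemma topspace_seminorm_topology [simp]: "topspace (seminorm_topology \<A>) = UNIV"
  by (auto simp: seminorm_topology_def)

text \<open>Sublevel sets are preimages of generating balls; superlevel sets are open by the reverse
  triangle inequality.\<close>

lemma continuous_map_seminorm_diff:
  assumes vs: "vector_space smul" and p: "seminorm smul p" "p \<in> \<A>"
    and f: "continuous_map X (seminorm_topology \<A>) f"
  shows "continuous_map X euclideanreal (\<lambda>s. p (f s - y))"
proof -
  have ball: "openin X {s \<in> topspace X. p (f s - z) < r}" for z r
  proof (cases "r > 0")
    case True
    have "openin (seminorm_topology \<A>) {y. p (y - z) < r}"
      unfolding seminorm_topology_def
      by (rule topology_generated_by_Basis) (use True p(2) in auto)
    from openin_continuous_map_preimage[OF f this] show ?thesis by simp
  next
    case False
    have "{s \<in> topspace X. p (f s - z) < r} = {}"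
      using False seminorm_nonneg[OF p(1)] by (auto simp: not_less intro: order_trans)
    then show ?thesis by (simp only: openin_empty)
  qed
  have "openin X {s \<in> topspace X. r < p (f s - y)}" for r
  proof (subst openin_subopen, intro ballI)
    fix s assume s: "s \<in> {s \<in> topspace X. r < p (f s - y)}"
    \<comment> \<open>The radius is the slack in \<open>r < p (f s - y)\<close>, so the triangle
      inequality keeps the value above \<open>r\<close> on \<open>?B\<close>.\<close>
    let ?B = "{s' \<in> topspace X. p (f s' - f s) < p (f s - y) - r}"
    have "r < p (f s' - y)" if "s' \<in> ?B" for s'
      using that seminorm_triangle[OF p(1), of "f s - f s'" "f s' - y"]
        seminorm_diff_commute[OF vs p(1), of "f s" "f s'"] by simp
    moreover have "s \<in> ?B" using s seminorm_zero[OF vs p(1)] by simp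
    ultimately show "\<exists>T. openin X T \<and> s \<in> T \<and> T \<subseteq> {s \<in> topspace X. r < p (f s - y)}"
      using ball by (intro exI[of _ ?B]) auto
  qed
  with ball show ?thesis
    by (auto simp: continuous_map_upper_lower_semicontinuous_lt)
qed

text \<open>Generating balls have arbitrary centres, but the ball about \<open>g s\<close> of radius
  \<open>r - p (g s - x)\<close> lies inside the ball of radius \<open>r\<close> about
  \<open>x\<close>. Hence balls centred at values of \<open>g\<close> suffice.\<close>

lemma continuous_map_seminorm_topologyI:
  assumes sn: "\<And>p. p \<in> \<A> \<Longrightarrow> seminorm smul p"
    and g: "\<And>p s r. \<lbrakk>p \<in> \<A>; s \<in> topspace X; 0 < r\<rbrakk> \<Longrightarrow>
      \<exists>N. openin X N \<and> s \<in> N \<and> (\<forall>t\<in>N. p (g t - g s) < r)"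
  shows "continuous_map X (seminorm_topology \<A>) g"
proof -
  have "openin X (g -` {y. p (y - x) < r} \<inter> topspace X)" if p: "p \<in> \<A>" for p x r
  proof (subst openin_subopen, intro ballI)
    fix s assume s: "s \<in> g -` {y. p (y - x) < r} \<inter> topspace X"
    then obtain N where N: "openin X N" "s \<in> N" "\<forall>t\<in>N. p (g t - g s) < r - p (g s - x)"
      using g[OF p, of s "r - p (g s - x)"] by auto
    have "p (g t - x) < r" if "t \<in> N" for t
      using seminorm_triangle[OF sn[OF p], of "g t - g s" "g s - x"] N(3) that by force
    then show "\<exists>T. openin X T \<and> s \<in> T \<and> T \<subseteq> g -` {y. p (y - x) < r} \<inter> topspace X"
      using N openin_subset by (intro exI[of _ N]) blast
  qed
  then show ?thesis
    unfolding seminorm_topology_def by (auto simp: continuous_on_generated_topo_iff)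
qed

text \<open>Products of nonnegative upper semicontinuous functions are upper semicontinuous. This
  supplies closedness when compactness is inherited from a larger set, and openness of
  neighbourhoods defined through a merely semicontinuous weight.\<close>

lemma closedin_usc_mult_ge:
  assumes v: "upper_semicontinuous_map X v" "\<And>t. t \<in> topspace X \<Longrightarrow> 0 \<le> v t"
    and g: "continuous_map X euclideanreal g" "\<And>t. t \<in> topspace X \<Longrightarrow> 0 \<le> g t"
  shows "closedin X {t \<in> topspace X. v t * g t \<ge> e}"
proof -
  have "openin X {t \<in> topspace X. v t * g t < e}"
  proof (subst openin_subopen, intro ballI)
    fix t assume t: "t \<in> {t \<in> topspace X. v t * g t < e}"
    \<comment> \<open>Raising both factors by a small \<open>d > 0\<close> leaves the product below
      \<open>e\<close>. Since the factors are nonnegative, this bounds the product at every point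
      where each factor grows by less than \<open>d\<close>.\<close>
    have "((\<lambda>d. (v t + d) * (g t + d)) \<longlongrightarrow> (v t + 0) * (g t + 0)) (at_right 0)"
      by (intro tendsto_intros)
    with t have "\<forall>\<^sub>F d in at_right 0. (v t + d) * (g t + d) < e"
      by (intro order_tendstoD(2)) auto
    then have "\<forall>\<^sub>F d in at_right 0. (v t + d) * (g t + d) < e \<and> 0 < d"
      by (intro eventually_conj eventually_at_right_less)
    then obtain d where d: "(v t + d) * (g t + d) < e" "0 < d"
      using eventually_happens'[OF trivial_limit_at_right_real] by blast
    let ?N = "{s \<in> topspace X. v s < v t + d} \<inter> {s \<in> topspace X. g s < g t + d}"
    have "v s * g s < e" if "s \<in> ?N" for s
    proof -
      have "v s * g s \<le> (v t + d) * (g t + d)"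
        using that v(2) g(2) t d(2) by (intro mult_mono) auto
      with d(1) show ?thesis by simp
    qed
    moreover have "openin X ?N"
      using v(1) g(1)
      by (auto simp: upper_semicontinuous_map_def continuous_map_upper_lower_semicontinuous_lt)
    ultimately show "\<exists>T. openin X T \<and> t \<in> T \<and> T \<subseteq> {t \<in> topspace X. v t * g t < e}"
      using t d(2) by (intro exI[of _ ?N]) auto
  qed
  moreover have "topspace X - {t \<in> topspace X. v t * g t \<ge> e} = {t \<in> topspace X. v t * g t < e}"
    by auto
  ultimately show ?thesis by (simp add: closedin_def)
qed

section \<open>Tensor functions and the weighted space \<open>CV0\<close>\<close>

lemma module_pointwise:
  assumes "vector_space smul"
  shows "module (\<lambda>c f t. smul c (f t))"
proof -
  interpret vector_space smul by fact
  show ?thesis by unfold_locales (auto simp: fun_eq_iff scale_right_distrib scale_left_distrib)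
qed

lemma sum_fun_apply: "(\<Sum>i\<in>F. g i) t = (\<Sum>i\<in>F. g i t)"
  for g :: "'i \<Rightarrow> 'a \<Rightarrow> 'x::comm_monoid_add"
  by (induction F rule: infinite_finite_induct) (simp_all add: zero_fun_def plus_fun_def)

lemma tensor_sum:
  assumes "vector_space smul" "\<And>i. i \<in> F \<Longrightarrow> \<phi> i \<in> A"
  shows "(\<lambda>t. \<Sum>i\<in>F. smul (\<phi> i t) (y i)) \<in> tensor smul A"
proof -
  interpret module "\<lambda>c f t. smul c (f t)" by (rule module_pointwise) fact
  have "(\<Sum>i\<in>F. (\<lambda>t. smul (\<phi> i t) (y i))) \<in> tensor smul A"
    unfolding tensor_def by (intro span_sum span_base) (use assms(2) in auto)
  moreover have "(\<Sum>i\<in>F. (\<lambda>t. smul (\<phi> i t) (y i))) = (\<lambda>t. \<Sum>i\<in>F. smul (\<phi> i t) (y i))"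
    by (rule ext) (rule sum_fun_apply)
  ultimately show ?thesis by simp
qed

lemma tensor_add:
  assumes "vector_space smul" "f \<in> tensor smul A" "g \<in> tensor smul A"
  shows "(\<lambda>t. f t + g t) \<in> tensor smul A"
proof -
  interpret module "\<lambda>c f t. smul c (f t)" by (rule module_pointwise) fact
  show ?thesis
    using span_add assms(2,3) unfolding tensor_def plus_fun_def by blast
qed

text \<open>Lets the inclusion of a span in \<open>CV0\<close> be checked on generators. Level sets
  of sums and multiples are closed and lie in level sets already known to be compact.\<close>

lemma subspace_CV0:
  assumes vs: "vector_space smul" and sn: "\<And>p. p \<in> \<A> \<Longrightarrow> seminorm smul p"
    and V: "nachbin_family X V"
  shows "module.subspace (\<lambda>c f t. smul c (f t)) (CV0 X \<A> V)"
proof -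
  interpret vs: vector_space smul by fact
  interpret module "\<lambda>c f t. smul c (f t)" by (rule module_pointwise) fact
  have closed: "closedin X {t \<in> topspace X. v t * p (h t) \<ge> e}"
    if "continuous_map X (seminorm_topology \<A>) h" "v \<in> V" "p \<in> \<A>" for h v p e
    using closedin_usc_mult_ge[of X v "\<lambda>t. p (h t)" e] V that
      continuous_map_seminorm_diff[OF vs sn _ that(1), of p 0] seminorm_nonneg[OF sn]
    by (auto simp: nachbin_family_def)
  show ?thesis
  proof (rule subspaceI)
    show "0 \<in> CV0 X \<A> V"
      unfolding CV0_def zero_fun_def by (simp add: seminorm_zero[OF vs sn] Ball_def)
  next
    fix f g assume f: "f \<in> CV0 X \<A> V" and g: "g \<in> CV0 X \<A> V"
    have cont: "continuous_map X (seminorm_topology \<A>) (f + g)"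
    proof (rule continuous_map_seminorm_topologyI[OF sn])
      fix p s and r :: real assume p: "p \<in> \<A>" and s: "s \<in> topspace X" and r: "0 < r"
      let ?B = "\<lambda>h. {t \<in> topspace X. p (h t - h s) < r / 2}"
      have op: "openin X (?B h)" if "h \<in> CV0 X \<A> V" for h
        using continuous_map_seminorm_diff[OF vs sn[OF p] p, of X h "h s"] that
        unfolding CV0_def continuous_map_upper_lower_semicontinuous_lt by blast
      have "p ((f + g) t - (f + g) s) < r" if "t \<in> ?B f \<inter> ?B g" for t
        using that seminorm_triangle[OF sn[OF p], of "f t - f s" "g t - g s"]
        by (auto simp: algebra_simps)
      then show "\<exists>N. openin X N \<and> s \<in> N \<and> (\<forall>t\<in>N. p ((f + g) t - (f + g) s) < r)"
        using op[OF f] op[OF g] s r seminorm_zero[OF vs sn[OF p]]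
        by (intro exI[of _ "?B f \<inter> ?B g"]) auto
    qed
    have "compactin X {t \<in> topspace X. v t * p ((f + g) t) \<ge> e}"
      if v: "v \<in> V" and p: "p \<in> \<A>" and e: "0 < e" for v p e
    proof (rule closed_compactin)
      \<comment> \<open>If both weighted values were below \<open>e / 2\<close>, the triangle
        inequality would put that of \<open>f + g\<close> below \<open>e\<close>.\<close>
      let ?K = "\<lambda>h. {t \<in> topspace X. v t * p (h t) \<ge> e / 2}"
      show "compactin X (?K f \<union> ?K g)"
        using f g v p half_gt_zero[OF e] unfolding CV0_def by (intro compactin_Un) blast+
      show "{t \<in> topspace X. v t * p ((f + g) t) \<ge> e} \<subseteq> ?K f \<union> ?K g"
      proof
        fix t assume t: "t \<in> {t \<in> topspace X. v t * p ((f + g) t) \<ge> e}"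
        have "v t * p (f t + g t) \<le> v t * (p (f t) + p (g t))"
          using V v t seminorm_triangle[OF sn[OF p]]
          by (intro mult_left_mono) (auto simp: nachbin_family_def)
        with t show "t \<in> ?K f \<union> ?K g" by (auto simp: distrib_left)
      qed
      show "closedin X {t \<in> topspace X. v t * p ((f + g) t) \<ge> e}"
        by (rule closed[OF cont v p])
    qed
    with cont show "f + g \<in> CV0 X \<A> V" by (auto simp: CV0_def)
  next
    fix c f assume f: "f \<in> CV0 X \<A> V"
    have cont: "continuous_map X (seminorm_topology \<A>) (\<lambda>t. smul c (f t))"
    proof (rule continuous_map_seminorm_topologyI[OF sn])
      fix p s and r :: real assume p: "p \<in> \<A>" and s: "s \<in> topspace X" and r: "0 < r"
      let ?B = "{t \<in> topspace X. cmod c * p (f t - f s) < r}"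
      have "continuous_map X euclideanreal (\<lambda>t. cmod c * p (f t - f s))"
        using f p by (intro continuous_intros continuous_map_seminorm_diff[OF vs sn])
          (auto simp: CV0_def)
      then have "openin X ?B"
        by (auto simp: continuous_map_upper_lower_semicontinuous_lt)
      moreover have "p (smul c (f t) - smul c (f s)) = cmod c * p (f t - f s)" for t
        by (simp add: seminorm_smul[OF sn[OF p]] flip: vs.scale_right_diff_distrib)
      ultimately show "\<exists>N. openin X N \<and> s \<in> N \<and> (\<forall>t\<in>N. p (smul c (f t) - smul c (f s)) < r)"
        using s r seminorm_zero[OF vs sn[OF p]] by (intro exI[of _ ?B]) auto
    qed
    have "compactin X {t \<in> topspace X. v t * p (smul c (f t)) \<ge> e}"
      if v: "v \<in> V" and p: "p \<in> \<A>" and e: "0 < e" for v p e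
    proof (rule closed_compactin)
      \<comment> \<open>The denominator is \<open>cmod c + 1\<close> rather than
        \<open>cmod c\<close> so that \<open>c = 0\<close> is covered.\<close>
      let ?K = "{t \<in> topspace X. v t * p (f t) \<ge> e / (cmod c + 1)}"
      show "compactin X ?K"
        using f v p e by (auto simp: CV0_def add_nonneg_pos)
      show "{t \<in> topspace X. v t * p (smul c (f t)) \<ge> e} \<subseteq> ?K"
      proof
        fix t assume t: "t \<in> {t \<in> topspace X. v t * p (smul c (f t)) \<ge> e}"
        then have "0 \<le> v t * p (f t)"
          using V v seminorm_nonneg[OF sn[OF p]] by (auto simp: nachbin_family_def)
        moreover have "e \<le> v t * p (f t) * cmod c"
          using t by (simp add: seminorm_smul[OF sn[OF p]] mult_ac)
        ultimately have "e \<le> v t * p (f t) * (cmod c + 1)"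
          by (simp add: distrib_left)
        with t show "t \<in> ?K" by (simp add: divide_le_eq add_nonneg_pos)
      qed
      show "closedin X {t \<in> topspace X. v t * p (smul c (f t)) \<ge> e}"
        by (rule closed[OF cont v p])
    qed
    with cont show "(\<lambda>t. smul c (f t)) \<in> CV0 X \<A> V" by (auto simp: CV0_def)
  qed
qed

text \<open>It suffices to treat one generator. Its level sets are closed and lie in the compact
  support of \<open>\<phi>\<close>, since the weighted seminorm is \<open>0\<close> wherever
  \<open>\<phi>\<close> vanishes.\<close>

lemma tensor_Cc_subset_CV0:
  assumes vs: "vector_space smul" and sn: "\<And>p. p \<in> \<A> \<Longrightarrow> seminorm smul p"
    and V: "nachbin_family X V"
  shows "tensor smul (Cc X euclidean) \<subseteq> CV0 X \<A> V"
proof -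
  interpret vs: vector_space smul by fact
  interpret module "\<lambda>c f t. smul c (f t)" by (rule module_pointwise) fact
  have "(\<lambda>t. smul (\<phi> t) x) \<in> CV0 X \<A> V" if \<phi>: "\<phi> \<in> Cc X euclidean" for \<phi> x
  proof -
    have \<phi>_cont: "continuous_map X euclidean \<phi>" using \<phi> by (simp add: Cc_def)
    have cont: "continuous_map X (seminorm_topology \<A>) (\<lambda>t. smul (\<phi> t) x)"
    proof (rule continuous_map_seminorm_topologyI[OF sn])
      fix p s and r :: real assume p: "p \<in> \<A>" and s: "s \<in> topspace X" and r: "0 < r"
      let ?B = "{t \<in> topspace X. cmod (\<phi> t - \<phi> s) * p x < r}"
      have "continuous_map X euclideanreal (\<lambda>t. cmod (\<phi> t - \<phi> s) * p x)"
        by (intro continuous_intros continuous_map_norm \<phi>_cont continuous_map_diff)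
      then have "openin X ?B"
        by (auto simp: continuous_map_upper_lower_semicontinuous_lt)
      moreover have "p (smul (\<phi> t) x - smul (\<phi> s) x) = cmod (\<phi> t - \<phi> s) * p x" for t
        by (simp add: seminorm_smul[OF sn[OF p]] flip: vs.scale_left_diff_distrib)
      ultimately show "\<exists>N. openin X N \<and> s \<in> N \<and> (\<forall>t\<in>N. p (smul (\<phi> t) x - smul (\<phi> s) x) < r)"
        using s r by (intro exI[of _ ?B]) auto
    qed
    have "compactin X {t \<in> topspace X. v t * p (smul (\<phi> t) x) \<ge> e}"
      if v: "v \<in> V" and p: "p \<in> \<A>" and e: "0 < e" for v p e
    proof (rule closed_compactin)
      show "compactin X (supp X \<phi>)" using \<phi> by (simp add: Cc_def)
      have "{t \<in> topspace X. v t * p (smul (\<phi> t) x) \<ge> e} \<subseteq> {t \<in> topspace X. \<phi> t \<noteq> 0}"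
        using e seminorm_zero[OF vs sn[OF p]] by auto
      also have "\<dots> \<subseteq> supp X \<phi>"
        unfolding supp_def by (rule closure_of_subset) auto
      finally show "{t \<in> topspace X. v t * p (smul (\<phi> t) x) \<ge> e} \<subseteq> supp X \<phi>" .
      show "closedin X {t \<in> topspace X. v t * p (smul (\<phi> t) x) \<ge> e}"
        using V v p continuous_map_seminorm_diff[OF vs sn[OF p] p cont, of 0]
          seminorm_nonneg[OF sn[OF p]]
        by (intro closedin_usc_mult_ge) (auto simp: nachbin_family_def)
    qed
    with cont show ?thesis by (auto simp: CV0_def)
  qed
  then show ?thesis
    unfolding tensor_def by (intro span_minimal subspace_CV0[OF vs sn V]) auto
qed

section \<open>Convex combinations and interpolation\<close>

text \<open>The weight left over by the \<open>a i\<close> is carried by \<open>y\<close>, so the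
  expression is a finite convex combination even before taking the closure. The form matches the
  values of the approximant with background \<open>y\<close>.\<close>

lemma convex_combination_in_closed_convex_hull:
  assumes vs: "vector_space smul" and F: "finite F" "\<And>i. i \<in> F \<Longrightarrow> z i \<in> S" and y: "y \<in> S"
    and a: "\<And>i. i \<in> F \<Longrightarrow> 0 \<le> a i" "(\<Sum>i\<in>F. a i) \<le> 1"
  shows "y + (\<Sum>i\<in>F. smul (complex_of_real (a i)) (z i - y)) \<in> closed_convex_hull smul \<A> S"
proof -
  interpret vector_space smul by fact
  define G where "G = insert y (z ` F)"
  \<comment> \<open>Combinations in the hull are indexed by distinct points, whereas
    \<open>z\<close> may repeat values, so the weights of equal points are added up. The point
    \<open>y\<close> also receives the leftover weight.\<close>
  define c where "c x = (\<Sum>i | i \<in> F \<and> z i = x. a i) + (if x = y then 1 - (\<Sum>i\<in>F. a i) else 0)" for x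
  have G: "finite G" "G \<subseteq> S" "z ` F \<subseteq> G" "y \<in> G" using F y by (auto simp: G_def)
  have c_nonneg: "0 \<le> c x" for x
    using a by (auto simp: c_def intro!: add_nonneg_nonneg sum_nonneg)
  have c_sum: "(\<Sum>x\<in>G. c x) = 1"
    using G sum.group[OF F(1) G(1,3), of a] by (simp add: c_def sum.distrib)
  have *: "smul (complex_of_real (c x)) x = (\<Sum>i | i \<in> F \<and> z i = x. smul (complex_of_real (a i)) (z i))
      + (if x = y then smul (complex_of_real (1 - (\<Sum>i\<in>F. a i))) y else 0)" for x
    by (auto simp: c_def scale_left_distrib scale_sum_left)
  have "(\<Sum>x\<in>G. smul (complex_of_real (c x)) x)
      = (\<Sum>i\<in>F. smul (complex_of_real (a i)) (z i)) + smul (complex_of_real (1 - (\<Sum>i\<in>F. a i))) y"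
    unfolding * using G sum.group[OF F(1) G(1,3), of "\<lambda>i. smul (complex_of_real (a i)) (z i)"]
    by (simp add: sum.distrib)
  also have "\<dots> = y + (\<Sum>i\<in>F. smul (complex_of_real (a i)) (z i - y))"
    by (simp add: scale_right_diff_distrib scale_left_diff_distrib sum_subtractf scale_sum_left)
  finally have eq: "y + (\<Sum>i\<in>F. smul (complex_of_real (a i)) (z i - y)) = (\<Sum>x\<in>G. smul (complex_of_real (c x)) x)"
    by simp
  let ?H = "{\<Sum>x\<in>F. smul (complex_of_real (c x)) x | F c.
        finite F \<and> F \<subseteq> S \<and> (\<forall>x\<in>F. 0 \<le> c x) \<and> (\<Sum>x\<in>F. c x) = 1}"
  have "y + (\<Sum>i\<in>F. smul (complex_of_real (a i)) (z i - y)) \<in> ?H"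
    unfolding eq using G c_nonneg c_sum by blast
  moreover have "?H \<subseteq> closed_convex_hull smul \<A> S"
    unfolding closed_convex_hull_def by (rule closure_of_subset) simp
  ultimately show ?thesis by blast
qed

text \<open>
  Interpolation on \<open>T0\<close> is achieved by making the neighbourhood of \<open>t\<close> avoid \<open>T0 - {t}\<close>.
\<close>

lemma weighted_interpolation:
  assumes vs: "vector_space smul" and p: "seminorm smul p" "p \<in> \<A>"
    and \<Omega>: "completely_regular_space \<Omega>" "Hausdorff_space \<Omega>"
    and f: "continuous_map \<Omega> (seminorm_topology \<A>) f"
    and v: "upper_semicontinuous_map \<Omega> v" "\<And>t. t \<in> topspace \<Omega> \<Longrightarrow> 0 \<le> v t"
    and e: "0 < e" and K: "compactin \<Omega> {t \<in> topspace \<Omega>. v t * p (f t - y0) \<ge> e}"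
    and T0: "finite T0" "T0 \<subseteq> topspace \<Omega>"
    and U: "\<And>t. t \<in> topspace \<Omega> \<Longrightarrow> e \<le> v t * p (f t - y0) \<or> t \<in> T0 \<and> f t \<noteq> y0 \<Longrightarrow>
      openin \<Omega> (U t) \<and> t \<in> U t"
  obtains F and \<phi> :: "'a \<Rightarrow> 'a \<Rightarrow> real" and u where
    "finite F" "F \<subseteq> topspace \<Omega>"
    "\<And>i. i \<in> F \<Longrightarrow> continuous_map \<Omega> euclideanreal (\<phi> i)"
    "\<And>i t. i \<in> F \<Longrightarrow> t \<in> topspace \<Omega> \<Longrightarrow> 0 \<le> \<phi> i t"
    "\<And>t. t \<in> topspace \<Omega> \<Longrightarrow> (\<Sum>i\<in>F. \<phi> i t) \<le> 1"
    "\<And>i t. i \<in> F \<Longrightarrow> t \<in> topspace \<Omega> \<Longrightarrow> \<phi> i t \<noteq> 0 \<Longrightarrow> t \<in> U i"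
    "u = (\<lambda>t. y0 + (\<Sum>i\<in>F. smul (complex_of_real (\<phi> i t)) (f i - y0)))"
    "\<And>t. t \<in> T0 \<Longrightarrow> u t = f t"
    "weighted_sup \<Omega> v p (\<lambda>t. f t - u t) \<le> ennreal e"
proof -
  interpret vector_space smul by fact
  note p_cont = continuous_map_seminorm_diff[OF vs p f]
  define K where "K = {t \<in> topspace \<Omega>. v t * p (f t - y0) \<ge> e}"
  \<comment> \<open>Where \<open>f t = y0\<close> the background is already the right value, and
    \<open>U\<close> is not assumed to give a neighbourhood there.\<close>
  define T1 where "T1 = {t \<in> T0. f t \<noteq> y0}"
  define N where "N t = {s \<in> topspace \<Omega>. v s * p (f s - f t) < e}" for t
  have p0: "p 0 = 0" by (rule seminorm_zero[OF vs p(1)])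
  have compact: "compactin \<Omega> (K \<union> T1)"
    unfolding K_def T1_def by (rule compactin_Un[OF K finite_imp_compactin]) (use T0 in auto)
  \<comment> \<open>The weight is only semicontinuous, so \<open>N t\<close> is obtained as the
    complement of a closed level set.\<close>
  have N: "openin \<Omega> (N t)" for t
  proof -
    have "closedin \<Omega> {s \<in> topspace \<Omega>. e \<le> v s * p (f s - f t)}"
      using v p_cont seminorm_nonneg[OF p(1)] by (intro closedin_usc_mult_ge) auto
    then have "openin \<Omega> (topspace \<Omega> - {s \<in> topspace \<Omega>. e \<le> v s * p (f s - f t)})"
      by (rule openin_diff[OF openin_topspace])
    moreover have "topspace \<Omega> - {s \<in> topspace \<Omega>. e \<le> v s * p (f s - f t)} = N t"
      by (auto simp: N_def)
    ultimately show ?thesis by simp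
  qed
  have closed: "closedin \<Omega> (T0 - {t})" for t
    using T0 \<Omega>(2) by (intro compactin_imp_closedin finite_imp_compactin) auto
  obtain F \<phi> where F: "finite F" "F \<subseteq> K \<union> T1"
    "\<And>i. i \<in> F \<Longrightarrow> continuous_map \<Omega> euclideanreal (\<phi> i)"
    and \<phi>_nonneg: "\<And>i t. i \<in> F \<Longrightarrow> t \<in> topspace \<Omega> \<Longrightarrow> 0 \<le> \<phi> i t"
    and \<phi>_le: "\<And>t. t \<in> topspace \<Omega> \<Longrightarrow> (\<Sum>i\<in>F. \<phi> i t) \<le> 1"
    and \<phi>_eq: "\<And>t. t \<in> K \<union> T1 \<Longrightarrow> (\<Sum>i\<in>F. \<phi> i t) = 1"
    and \<phi>_supp: "\<And>i t. i \<in> F \<Longrightarrow> t \<in> topspace \<Omega> \<Longrightarrow> \<phi> i t \<noteq> 0 \<Longrightarrow> t \<in> U i \<inter> N i - (T0 - {i})"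
  proof (rule completely_regular_partition_of_unity[OF \<Omega>(1) compact, of "\<lambda>t. U t \<inter> N t - (T0 - {t})"])
    fix t assume t: "t \<in> K \<union> T1"
    then have "t \<in> topspace \<Omega>" using T0 by (auto simp: K_def T1_def)
    moreover from this have "openin \<Omega> (U t)" "t \<in> U t"
      using U[of t] t by (auto simp: K_def T1_def)
    ultimately show "openin \<Omega> (U t \<inter> N t - (T0 - {t})) \<and> t \<in> U t \<inter> N t - (T0 - {t})"
      using N[of t] closed[of t] e p0 by (auto simp: N_def intro!: openin_diff)
  qed blast
  have F_top: "F \<subseteq> topspace \<Omega>" using F(2) T0 by (auto simp: K_def T1_def)
  define u where "u = (\<lambda>t. y0 + (\<Sum>i\<in>F. smul (complex_of_real (\<phi> i t)) (f i - y0)))"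
  have "u t = f t" if t: "t \<in> T0" for t
  proof -
    \<comment> \<open>At a point \<open>t\<close> of \<open>T0\<close> the only index that can have
      nonzero weight is \<open>t\<close> itself, so \<open>f i\<close> may be replaced by
      \<open>f t\<close>.\<close>
    have "(\<Sum>i\<in>F. smul (complex_of_real (\<phi> i t)) (f i - y0))
        = (\<Sum>i\<in>F. smul (complex_of_real (\<phi> i t)) (f t - y0))"
    proof (rule sum.cong[OF refl])
      fix i assume "i \<in> F"
      from \<phi>_supp[OF this, of t] show "smul (complex_of_real (\<phi> i t)) (f i - y0)
          = smul (complex_of_real (\<phi> i t)) (f t - y0)"
        using t T0 by (cases "\<phi> i t = 0") auto
    qed
    then have "u t = y0 + smul (complex_of_real (\<Sum>i\<in>F. \<phi> i t)) (f t - y0)"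
      by (simp add: u_def scale_sum_left)
    also have "\<dots> = f t"
      \<comment> \<open>Either \<open>t \<in> T1\<close> and the weights sum to \<open>1\<close>, or
        \<open>f t = y0\<close> and the correction is zero whatever the sum is.\<close>
      using t \<phi>_eq[of t] by (cases "f t = y0") (simp_all add: T1_def)
    finally show ?thesis .
  qed
  moreover have "weighted_sup \<Omega> v p (\<lambda>t. f t - u t) \<le> ennreal e"
    unfolding weighted_sup_def
  proof (intro SUP_least ennreal_leI)
    fix t assume t: "t \<in> topspace \<Omega>"
    define S where "S = (\<Sum>i\<in>F. \<phi> i t)"
    have S: "S \<le> 1" using \<phi>_le[OF t] by (simp add: S_def)
    \<comment> \<open>Distributing \<open>f t\<close> over the total weight
      \<open>(1 - S) + S\<close> pairs it with the background and with each
      \<open>f i\<close>.\<close>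
    have "f t - u t = smul (complex_of_real (1 - S)) (f t - y0)
        + (\<Sum>i\<in>F. smul (complex_of_real (\<phi> i t)) (f t - f i))"
      by (simp add: u_def S_def scale_right_diff_distrib scale_left_diff_distrib sum_subtractf scale_sum_left
          flip: sum_distrib_left)
    then have "p (f t - u t) \<le> p (smul (complex_of_real (1 - S)) (f t - y0))
        + p (\<Sum>i\<in>F. smul (complex_of_real (\<phi> i t)) (f t - f i))"
      by (metis seminorm_triangle[OF p(1)])
    also have "\<dots> \<le> p (smul (complex_of_real (1 - S)) (f t - y0))
        + (\<Sum>i\<in>F. p (smul (complex_of_real (\<phi> i t)) (f t - f i)))"
      by (intro add_left_mono seminorm_sum_le[OF vs p(1)])
    also have "\<dots> = (1 - S) * p (f t - y0) + (\<Sum>i\<in>F. \<phi> i t * p (f t - f i))"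
      using S \<phi>_nonneg[OF _ t] by (simp add: seminorm_smul[OF p(1)] norm_of_real del: of_real_diff)
    finally have "v t * p (f t - u t) \<le> v t * ((1 - S) * p (f t - y0) + (\<Sum>i\<in>F. \<phi> i t * p (f t - f i)))"
      using v(2)[OF t] by (rule mult_left_mono)
    also have "\<dots> = (1 - S) * (v t * p (f t - y0)) + (\<Sum>i\<in>F. \<phi> i t * (v t * p (f t - f i)))"
      by (simp add: distrib_left sum_distrib_left mult_ac)
    also have "\<dots> \<le> (1 - S) * e + (\<Sum>i\<in>F. \<phi> i t * e)"
    proof (intro add_mono sum_mono)
      show "(1 - S) * (v t * p (f t - y0)) \<le> (1 - S) * e"
      \<comment> \<open>On \<open>K\<close> the distance to the background may be large, but there
        \<open>S = 1\<close> removes the term.\<close>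
      proof (cases "t \<in> K")
        case True
        then show ?thesis using \<phi>_eq[of t] by (simp add: S_def)
      next
        case False
        then show ?thesis using S t by (intro mult_left_mono) (auto simp: K_def)
      qed
      show "\<phi> i t * (v t * p (f t - f i)) \<le> \<phi> i t * e" if "i \<in> F" for i
        using \<phi>_supp[OF that t] \<phi>_nonneg[OF that t]
        by (cases "\<phi> i t = 0") (auto simp: N_def)
    qed
    also have "\<dots> = e" by (simp add: S_def algebra_simps flip: sum_distrib_left)
    finally show "v t * p (f t - u t) \<le> e" .
  qed
  ultimately show thesis
    using that[OF F(1) F_top F(3) \<phi>_nonneg \<phi>_le _ u_def] \<phi>_supp by blast
qed

section \<open>Supports\<close>

lemma supp_subsetI:
  assumes "\<And>t. t \<in> topspace \<Omega> \<Longrightarrow> u t \<noteq> 0 \<Longrightarrow> t \<in> supp \<Omega> f"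
  shows "supp \<Omega> u \<subseteq> supp \<Omega> f"
  unfolding supp_def[of \<Omega> u]
  by (rule closure_of_minimal) (use assms in \<open>auto simp: supp_def\<close>)

text \<open>The vector space may fail to be Hausdorff, and then the set where \<open>f\<close> is
  nonzero may fail to be open. The set where \<open>p (f s)\<close> is positive is open by
  continuity of the seminorm and lies in the support.\<close>

lemma seminorm_pos_imp_interior_supp:
  assumes vs: "vector_space smul" and p: "seminorm smul p" "p \<in> \<A>"
    and f: "continuous_map \<Omega> (seminorm_topology \<A>) f"
    and t: "t \<in> topspace \<Omega>" "0 < p (f t)"
  shows "t \<in> \<Omega> interior_of (supp \<Omega> f)"
proof -
  let ?O = "{s \<in> topspace \<Omega>. 0 < p (f s)}"
  have "openin \<Omega> ?O"
    using continuous_map_seminorm_diff[OF vs p f, of 0]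
    by (simp add: continuous_map_upper_lower_semicontinuous_lt)
  moreover have "?O \<subseteq> supp \<Omega> f"
  proof -
    have "?O \<subseteq> {s \<in> topspace \<Omega>. f s \<noteq> 0}"
      using seminorm_zero[OF vs p(1)] by auto
    also have "\<dots> \<subseteq> supp \<Omega> f"
      unfolding supp_def by (rule closure_of_subset) auto
    finally show ?thesis .
  qed
  ultimately have "?O \<subseteq> \<Omega> interior_of (supp \<Omega> f)" by (intro interior_of_maximal)
  with t show ?thesis by blast
qed

theorem theorem3p14:
  fixes \<Omega> :: "'a topology"
    and smul :: "complex \<Rightarrow> 'x::ab_group_add \<Rightarrow> 'x"
    and \<A> :: "('x \<Rightarrow> real) set"
    and V :: "('a \<Rightarrow> real) set"
    and T0 :: "'a set"
  assumes "vector_space smul"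
    and "\<And>p. p \<in> \<A> \<Longrightarrow> seminorm smul p"
    and "nachbin_family \<Omega> V"
    and "finite T0" and "T0 \<subseteq> topspace \<Omega>"
  shows
    "(locally_compact_space \<Omega> \<and> Hausdorff_space \<Omega> \<longrightarrow>
        tensor smul (Cc \<Omega> euclidean) \<subseteq> CV0 \<Omega> \<A> V \<and>
        (\<forall>f \<in> CV0 \<Omega> \<A> V. \<forall>\<epsilon>::real. \<epsilon> > 0 \<longrightarrow> (\<forall>v\<in>V. \<forall>p\<in>\<A>.
          \<exists>u \<in> tensor smul (Cc \<Omega> euclidean).
            weighted_sup \<Omega> v p (\<lambda>t. f t - u t) < ennreal \<epsilon> \<and>
            (\<forall>t\<in>T0. u t = f t) \<and>
            u ` topspace \<Omega> \<subseteq> closed_convex_hull smul \<A> (f ` topspace \<Omega> \<union> {0}) \<and>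
            ((\<forall>t\<in>T0. f t \<noteq> 0 \<longrightarrow> t \<in> \<Omega> interior_of (supp \<Omega> f)) \<longrightarrow> supp \<Omega> u \<subseteq> supp \<Omega> f))))
     \<and>
     (completely_regular_space \<Omega> \<and> Hausdorff_space \<Omega> \<longrightarrow>
        (\<forall>f \<in> Cb \<Omega> (seminorm_topology \<A>) \<A>. \<forall>\<epsilon>::real. \<epsilon> > 0 \<longrightarrow> (\<forall>v \<in> C0_nonneg \<Omega>. \<forall>p\<in>\<A>.
          \<exists>u \<in> tensor smul (Cb \<Omega> euclidean {norm}).
            weighted_sup \<Omega> v p (\<lambda>t. f t - u t) < ennreal \<epsilon> \<and>
            (\<forall>t\<in>T0. u t = f t) \<and>
            u ` topspace \<Omega> \<subseteq> closed_convex_hull smul \<A> (f ` topspace \<Omega>) \<and>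
            ((\<forall>t\<in>T0. f t \<noteq> 0 \<longrightarrow> t \<in> \<Omega> interior_of (supp \<Omega> f)) \<longrightarrow> supp \<Omega> u \<subseteq> supp \<Omega> f))))"
proof (intro conjI impI ballI allI)

  \<comment> \<open>Compactly supported interpolants on a locally compact space\<close>
  note vs = assms(1) and sn = assms(2) and V = assms(3) and T0 = assms(4,5)
  assume "locally_compact_space \<Omega> \<and> Hausdorff_space \<Omega>"
  then have lc: "locally_compact_space \<Omega>" and H: "Hausdorff_space \<Omega>" by auto
  have cr: "completely_regular_space \<Omega>"
    using lc H locally_compact_regular_imp_completely_regular_space by blast
  show "tensor smul (Cc \<Omega> euclidean) \<subseteq> CV0 \<Omega> \<A> V"
    by (rule tensor_Cc_subset_CV0[OF vs sn V])
  fix f v p and \<epsilon> :: real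
  assume f: "f \<in> CV0 \<Omega> \<A> V" and \<epsilon>: "0 < \<epsilon>" and v: "v \<in> V" and p: "p \<in> \<A>"
  have f_cont: "continuous_map \<Omega> (seminorm_topology \<A>) f" using f by (simp add: CV0_def)
  \<comment> \<open>One choice serves both cases of the support implication: under its hypothesis on
    \<open>T0\<close> the bumps are confined to the interior of the support, otherwise nothing is
    claimed and they may live anywhere.\<close>
  define W where "W = (if \<forall>t\<in>T0. f t \<noteq> 0 \<longrightarrow> t \<in> \<Omega> interior_of (supp \<Omega> f)
    then \<Omega> interior_of (supp \<Omega> f) else topspace \<Omega>)"
  \<comment> \<open>Placing the bumps inside the compact sets \<open>C t\<close> will make their
    supports compact.\<close>
  obtain O' C where C: "\<And>t. t \<in> topspace \<Omega> \<Longrightarrow>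
      openin \<Omega> (O' t) \<and> compactin \<Omega> (C t) \<and> t \<in> O' t \<and> O' t \<subseteq> C t"
    using lc unfolding locally_compact_space_def by metis
  have U: "openin \<Omega> (O' t \<inter> W) \<and> t \<in> O' t \<inter> W"
    if t: "t \<in> topspace \<Omega>" "\<epsilon> / 2 \<le> v t * p (f t - 0) \<or> t \<in> T0 \<and> f t \<noteq> 0" for t
  proof -
    have "t \<in> W"
    \<comment> \<open>A large weighted value forces \<open>p (f t) > 0\<close>, hence an interior
      point of the support. The remaining points come from \<open>T0\<close> and are handled by the
      case distinction in \<open>W\<close>.\<close>
    proof (cases "\<epsilon> / 2 \<le> v t * p (f t - 0)")
      case True
      then have "p (f t) \<noteq> 0" using \<epsilon> by auto
      then have "0 < p (f t)" using seminorm_nonneg[OF sn[OF p], of "f t"] by linarith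
      then show ?thesis
        using seminorm_pos_imp_interior_supp[OF vs sn[OF p] p f_cont t(1)] t(1)
        by (simp add: W_def)
    next
      case False
      then show ?thesis using t by (auto simp: W_def)
    qed
    with C[OF t(1)] show ?thesis by (auto simp: W_def)
  qed
  \<comment> \<open>The interpolation bound is not strict, hence
    \<open>\<epsilon> / 2\<close>.\<close>
  obtain F \<phi> u where F: "F \<subseteq> topspace \<Omega>" "finite F"
    and \<phi>: "\<And>i. i \<in> F \<Longrightarrow> continuous_map \<Omega> euclideanreal (\<phi> i)"
      "\<And>i t. i \<in> F \<Longrightarrow> t \<in> topspace \<Omega> \<Longrightarrow> 0 \<le> \<phi> i t"
      "\<And>t. t \<in> topspace \<Omega> \<Longrightarrow> (\<Sum>i\<in>F. \<phi> i t) \<le> 1"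
      "\<And>i t. i \<in> F \<Longrightarrow> t \<in> topspace \<Omega> \<Longrightarrow> \<phi> i t \<noteq> 0 \<Longrightarrow> t \<in> O' i \<inter> W"
    and u: "u = (\<lambda>t. 0 + (\<Sum>i\<in>F. smul (complex_of_real (\<phi> i t)) (f i - 0)))"
    and u_T0: "\<And>t. t \<in> T0 \<Longrightarrow> u t = f t"
    and u_sup: "weighted_sup \<Omega> v p (\<lambda>t. f t - u t) \<le> ennreal (\<epsilon> / 2)"
  proof (rule weighted_interpolation[OF vs sn[OF p] p cr H f_cont, of v "\<epsilon> / 2" 0 T0 "\<lambda>t. O' t \<inter> W"])
    show "compactin \<Omega> {t \<in> topspace \<Omega>. \<epsilon> / 2 \<le> v t * p (f t - 0)}"
      using f v p half_gt_zero[OF \<epsilon>] unfolding CV0_def diff_zero by blast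
  qed (use V v \<epsilon> T0 U in \<open>auto simp: nachbin_family_def\<close>)
  have "(\<lambda>t. complex_of_real (\<phi> i t)) \<in> Cc \<Omega> euclidean" if i: "i \<in> F" for i
  proof -
    have C_i: "compactin \<Omega> (C i)" "O' i \<subseteq> C i" using C F i by auto
    \<comment> \<open>The set \<open>C i\<close> is compact in a Hausdorff space, hence closed, so
      taking the closure does not leave it.\<close>
    have "supp \<Omega> (\<lambda>t. complex_of_real (\<phi> i t)) \<subseteq> C i"
      unfolding supp_def
      by (rule closure_of_minimal) (use \<phi>(4)[OF i] C_i compactin_imp_closedin[OF H] in auto)
    then have "compactin \<Omega> (supp \<Omega> (\<lambda>t. complex_of_real (\<phi> i t)))"
      using C_i by (auto simp: supp_def intro: closed_compactin)
    moreover have "continuous_map \<Omega> euclidean (complex_of_real \<circ> \<phi> i)"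
      by (rule continuous_map_compose[OF \<phi>(1)[OF i]]) (auto intro!: continuous_intros)
    ultimately show ?thesis by (simp add: Cc_def o_def)
  qed
  then have "u \<in> tensor smul (Cc \<Omega> euclidean)"
    unfolding u by (simp add: tensor_sum[OF vs])
  moreover have "weighted_sup \<Omega> v p (\<lambda>t. f t - u t) < ennreal \<epsilon>"
    by (rule le_less_trans[OF u_sup]) (use \<epsilon> in \<open>auto simp: ennreal_less_iff\<close>)
  moreover have "u ` topspace \<Omega> \<subseteq> closed_convex_hull smul \<A> (f ` topspace \<Omega> \<union> {0})"
    using F \<phi> unfolding u by (auto intro!: convex_combination_in_closed_convex_hull[OF vs, where y = 0, simplified])
  moreover have "supp \<Omega> u \<subseteq> supp \<Omega> f"
    if hyp: "\<forall>t\<in>T0. f t \<noteq> 0 \<longrightarrow> t \<in> \<Omega> interior_of (supp \<Omega> f)"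
  proof (rule supp_subsetI)
    interpret vector_space smul by (rule vs)
    fix t assume t: "t \<in> topspace \<Omega>" "u t \<noteq> 0"
    \<comment> \<open>With background \<open>0\<close>, a nonzero value of \<open>u\<close> requires
      an active bump.\<close>
    then obtain i where "i \<in> F" "\<phi> i t \<noteq> 0"
      unfolding u by (force intro: sum.neutral)
    with \<phi>(4) t(1) have "t \<in> W" by blast
    then show "t \<in> supp \<Omega> f"
      using hyp interior_of_subset[of \<Omega> "supp \<Omega> f"] by (auto simp: W_def)
  qed
  ultimately show "\<exists>u \<in> tensor smul (Cc \<Omega> euclidean).
      weighted_sup \<Omega> v p (\<lambda>t. f t - u t) < ennreal \<epsilon> \<and>
      (\<forall>t\<in>T0. u t = f t) \<and>
      u ` topspace \<Omega> \<subseteq> closed_convex_hull smul \<A> (f ` topspace \<Omega> \<union> {0}) \<and>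
      ((\<forall>t\<in>T0. f t \<noteq> 0 \<longrightarrow> t \<in> \<Omega> interior_of (supp \<Omega> f)) \<longrightarrow> supp \<Omega> u \<subseteq> supp \<Omega> f)"
    using u_T0 by blast
next

  \<comment> \<open>Bounded interpolants on a completely regular space\<close>
  note vs = assms(1) and sn = assms(2) and T0 = assms(4,5)
  assume "completely_regular_space \<Omega> \<and> Hausdorff_space \<Omega>"
  then have cr: "completely_regular_space \<Omega>" and H: "Hausdorff_space \<Omega>" by auto
  fix f v p and \<epsilon> :: real
  assume f: "f \<in> Cb \<Omega> (seminorm_topology \<A>) \<A>" and \<epsilon>: "0 < \<epsilon>"
    and v: "v \<in> C0_nonneg \<Omega>" and p: "p \<in> \<A>"
  have f_cont: "continuous_map \<Omega> (seminorm_topology \<A>) f" using f by (simp add: Cb_def)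
  have v_nonneg: "\<And>t. t \<in> topspace \<Omega> \<Longrightarrow> 0 \<le> v t"
    and v_usc: "upper_semicontinuous_map \<Omega> v"
    using v by (auto simp: C0_nonneg_def upper_semicontinuous_map_def
        continuous_map_upper_lower_semicontinuous_lt)
  \<comment> \<open>Nonemptiness is included so that a value of \<open>f\<close> can be chosen as
    background; on the empty space \<open>y0 = 0\<close> serves.\<close>
  define full where "full \<longleftrightarrow> topspace \<Omega> \<noteq> {} \<and> supp \<Omega> f = topspace \<Omega>"
  obtain y0 where y0: "topspace \<Omega> \<noteq> {} \<Longrightarrow> y0 \<in> f ` topspace \<Omega>" and y0_0: "\<not> full \<Longrightarrow> y0 = 0"
  proof (cases full)
    case True
    then have "topspace \<Omega> \<noteq> {}" by (simp add: full_def)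
    with True show thesis using that by blast
  next
    case False
    \<comment> \<open>A function without zeros has the whole space as support, so outside the full
      case \<open>0\<close> is itself a value of \<open>f\<close>.\<close>
    have "0 \<in> f ` topspace \<Omega>" if ne: "topspace \<Omega> \<noteq> {}"
    proof (rule ccontr)
      assume "0 \<notin> f ` topspace \<Omega>"
      then have "{t \<in> topspace \<Omega>. f t \<noteq> 0} = topspace \<Omega>" by force
      with False ne show False by (simp add: full_def supp_def)
    qed
    then show thesis using that by blast
  qed
  define W where "W = (if \<not> full \<and> (\<forall>t\<in>T0. f t \<noteq> 0 \<longrightarrow> t \<in> \<Omega> interior_of (supp \<Omega> f))
    then \<Omega> interior_of (supp \<Omega> f) else topspace \<Omega>)"
  have W: "openin \<Omega> W \<and> t \<in> W"
    if t: "t \<in> topspace \<Omega>" "\<epsilon> / 2 \<le> v t * p (f t - y0) \<or> t \<in> T0 \<and> f t \<noteq> y0" for t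
  \<comment> \<open>Outside the full case \<open>y0 = 0\<close>, so a large weighted value again
    gives \<open>p (f t) > 0\<close>.\<close>
  proof (cases "\<not> full \<and> \<epsilon> / 2 \<le> v t * p (f t - y0)")
    case True
    then have "p (f t) \<noteq> 0" using \<epsilon> y0_0 by auto
    then have "0 < p (f t)" using seminorm_nonneg[OF sn[OF p], of "f t"] by linarith
    then show ?thesis
      using seminorm_pos_imp_interior_supp[OF vs sn[OF p] p f_cont t(1)] t(1)
      by (simp add: W_def)
  next
    case False
    then show ?thesis using t y0_0 by (auto simp: W_def)
  qed
  obtain F \<phi> u where F: "F \<subseteq> topspace \<Omega>" "finite F"
    and \<phi>: "\<And>i. i \<in> F \<Longrightarrow> continuous_map \<Omega> euclideanreal (\<phi> i)"
      "\<And>i t. i \<in> F \<Longrightarrow> t \<in> topspace \<Omega> \<Longrightarrow> 0 \<le> \<phi> i t"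
      "\<And>t. t \<in> topspace \<Omega> \<Longrightarrow> (\<Sum>i\<in>F. \<phi> i t) \<le> 1"
      "\<And>i t. i \<in> F \<Longrightarrow> t \<in> topspace \<Omega> \<Longrightarrow> \<phi> i t \<noteq> 0 \<Longrightarrow> t \<in> W"
    and u: "u = (\<lambda>t. y0 + (\<Sum>i\<in>F. smul (complex_of_real (\<phi> i t)) (f i - y0)))"
    and u_T0: "\<And>t. t \<in> T0 \<Longrightarrow> u t = f t"
    and u_sup: "weighted_sup \<Omega> v p (\<lambda>t. f t - u t) \<le> ennreal (\<epsilon> / 2)"
  proof (rule weighted_interpolation[OF vs sn[OF p] p cr H f_cont v_usc v_nonneg, of "\<epsilon> / 2" y0 T0 "\<lambda>_. W"])
    from f p obtain B where B: "\<And>t. t \<in> topspace \<Omega> \<Longrightarrow> \<bar>p (f t)\<bar> \<le> B"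
      unfolding Cb_def bounded_iff by auto blast
    \<comment> \<open>On the empty space \<open>B\<close> may be negative, hence
      \<open>max B 0\<close>. The summand \<open>1\<close> makes \<open>M\<close> positive, so that
      \<open>v t * M \<ge> \<epsilon> / 2\<close> can be solved for \<open>v t\<close> and the decay
      of \<open>v\<close> gives compactness.\<close>
    define M where "M = max B 0 + p y0 + 1"
    have M: "p (f t - y0) \<le> M" if "t \<in> topspace \<Omega>" for t
      using seminorm_triangle[OF sn[OF p], of "f t" "- y0"] B[OF that]
        seminorm_diff_commute[OF vs sn[OF p], of 0 y0] by (simp add: M_def)
    have M_pos: "0 < M"
      using seminorm_nonneg[OF sn[OF p], of y0] by (simp add: M_def)
    show "compactin \<Omega> {t \<in> topspace \<Omega>. \<epsilon> / 2 \<le> v t * p (f t - y0)}"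
    proof (rule closed_compactin)
      show "compactin \<Omega> {t \<in> topspace \<Omega>. v t \<ge> \<epsilon> / 2 / M}"
        using v \<epsilon> M_pos by (auto simp: C0_nonneg_def)
      show "{t \<in> topspace \<Omega>. \<epsilon> / 2 \<le> v t * p (f t - y0)} \<subseteq> {t \<in> topspace \<Omega>. v t \<ge> \<epsilon> / 2 / M}"
        using mult_left_mono[OF M v_nonneg] M_pos by (fastforce simp: divide_le_eq)
      show "closedin \<Omega> {t \<in> topspace \<Omega>. \<epsilon> / 2 \<le> v t * p (f t - y0)}"
        using continuous_map_seminorm_diff[OF vs sn[OF p] p f_cont] seminorm_nonneg[OF sn[OF p]]
        by (intro closedin_usc_mult_ge v_usc v_nonneg) auto
    qed
  qed (use \<epsilon> T0 W in auto)
  have "(\<lambda>t. complex_of_real (\<phi> i t)) \<in> Cb \<Omega> euclidean {norm}" if i: "i \<in> F" for i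
  proof -
    have "\<bar>\<phi> i t\<bar> \<le> 1" if t: "t \<in> topspace \<Omega>" for t
      using member_le_sum[of i F "\<lambda>i. \<phi> i t"] \<phi>(2,3) i F t by fastforce
    then have "bounded ((\<lambda>t. norm (complex_of_real (\<phi> i t))) ` topspace \<Omega>)"
      by (auto simp: bounded_iff)
    moreover have "continuous_map \<Omega> euclidean (complex_of_real \<circ> \<phi> i)"
      by (rule continuous_map_compose[OF \<phi>(1)[OF i]]) (auto intro!: continuous_intros)
    ultimately show ?thesis by (simp add: Cb_def o_def)
  qed
  then have "(\<lambda>t. \<Sum>i\<in>F. smul (complex_of_real (\<phi> i t)) (f i - y0)) \<in> tensor smul (Cb \<Omega> euclidean {norm})"
    by (rule tensor_sum[OF vs])
  \<comment> \<open>The background is the constant function \<open>1\<close> times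
    \<open>y0\<close>, and constants are bounded.\<close>
  moreover have "(\<lambda>t. y0) \<in> tensor smul (Cb \<Omega> euclidean {norm})"
  proof -
    interpret vector_space smul by (rule vs)
    have "(\<lambda>t. 1) \<in> Cb \<Omega> euclidean {norm :: complex \<Rightarrow> real}"
      by (auto simp: Cb_def bounded_iff)
    then show ?thesis
      using tensor_sum[OF vs, of "{()}" "\<lambda>_ _. 1" "Cb \<Omega> euclidean {norm}" "\<lambda>_. y0"] by simp
  qed
  ultimately have "u \<in> tensor smul (Cb \<Omega> euclidean {norm})"
    unfolding u by (intro tensor_add[OF vs])
  moreover have "weighted_sup \<Omega> v p (\<lambda>t. f t - u t) < ennreal \<epsilon>"
    by (rule le_less_trans[OF u_sup]) (use \<epsilon> in \<open>auto simp: ennreal_less_iff\<close>)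
  moreover have "u ` topspace \<Omega> \<subseteq> closed_convex_hull smul \<A> (f ` topspace \<Omega>)"
  proof (rule image_subsetI)
    fix t assume t: "t \<in> topspace \<Omega>"
    \<comment> \<open>The hull is taken of the values of \<open>f\<close> alone, so the background
      carrying the leftover weight must be one of them.\<close>
    then have "y0 \<in> f ` topspace \<Omega>" using y0 by blast
    then show "u t \<in> closed_convex_hull smul \<A> (f ` topspace \<Omega>)"
      unfolding u using F \<phi>(2,3) t
      by (intro convex_combination_in_closed_convex_hull[OF vs]) auto
  qed
  moreover have "supp \<Omega> u \<subseteq> supp \<Omega> f"
    if hyp: "\<forall>t\<in>T0. f t \<noteq> 0 \<longrightarrow> t \<in> \<Omega> interior_of (supp \<Omega> f)"
  proof (rule supp_subsetI)
    interpret vector_space smul by (rule vs)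
    fix t assume t: "t \<in> topspace \<Omega>" "u t \<noteq> 0"
    show "t \<in> supp \<Omega> f"
    \<comment> \<open>In the full case every point lies in the support, so a nonzero background does
      no harm.\<close>
    proof (cases full)
      case True
      then show ?thesis using t by (simp add: full_def)
    next
      case False
      with t obtain i where "i \<in> F" "\<phi> i t \<noteq> 0"
        unfolding u y0_0[OF False] by (force intro: sum.neutral)
      with \<phi>(4) t(1) have "t \<in> W" by blast
      then show ?thesis
        using hyp False interior_of_subset[of \<Omega> "supp \<Omega> f"] by (auto simp: W_def)
    qed
  qed
  ultimately show "\<exists>u \<in> tensor smul (Cb \<Omega> euclidean {norm}).
      weighted_sup \<Omega> v p (\<lambda>t. f t - u t) < ennreal \<epsilon> \<and>
      (\<forall>t\<in>T0. u t = f t) \<and>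
      u ` topspace \<Omega> \<subseteq> closed_convex_hull smul \<A> (f ` topspace \<Omega>) \<and>
      ((\<forall>t\<in>T0. f t \<noteq> 0 \<longrightarrow> t \<in> \<Omega> interior_of (supp \<Omega> f)) \<longrightarrow> supp \<Omega> u \<subseteq> supp \<Omega> f)"
    using u_T0 by blast
qed

end
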